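(* Let $\mathfrak h\subset\mathfrak g$ be an abelian subalgebra and $\lambda>0$. The left-invariant metric $h_\lambda$ obtained by scaling $\mathfrak h$ by $\lambda$ has nonnegative sectional curvature if and only if $|Z|_{h_\lambda}^2\le\tfrac43|Z|^2$ for every $Z\in[\mathfrak g,\mathfrak g]$.
   Context: $G$ is a compact Lie group with Lie algebra $\mathfrak g$ and bi-invariant metric $h_0$; $|Z|^2=h_0(Z,Z)$. $\mathfrak p$ is the $h_0$-orthogonal complement of $\mathfrak h$ and $Z^{\mathfrak h},Z^{\mathfrak p}$ the orthogonal projections of $Z$. Scaling $\mathfrak h$ by $\lambda>0$ means taking the left-invariant metric $h_\lambda(X,Y)=h_0(\lambda X^{\mathfrak h}+X^{\mathfrak p},Y)$ for $X,Y\in\mathfrak g$, and $|Z|_{h_\lambda}^2=h_\lambda(Z,Z)$. $[\mathfrak g,\mathfrak g]$ is the derived subalgebra. *)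

theory Defs
  imports "HOL-Analysis.Analysis"
begin

text \<open>The Lie algebra g is modelled as a finite-dimensional real inner product space
 (type class euclidean_space); its inner product is the bi-invariant metric h0.\<close>

definition is_lie_bracket :: "('a::euclidean_space \<Rightarrow> 'a \<Rightarrow> 'a) \<Rightarrow> bool" where
  "is_lie_bracket br \<longleftrightarrow> bilinear br \<and> (\<forall>X. br X X = 0) \<and>
     (\<forall>X Y Z. br X (br Y Z) + br Y (br Z X) + br Z (br X Y) = 0)"

definition ad_invariant :: "('a::euclidean_space \<Rightarrow> 'a \<Rightarrow> 'a) \<Rightarrow> bool" where
  "ad_invariant br \<longleftrightarrow> (\<forall>X Y Z. inner (br X Y) Z = - inner Y (br X Z))"

definition abelian_subalgebra :: "('a::euclidean_space \<Rightarrow> 'a \<Rightarrow> 'a) \<Rightarrow> 'a set \<Rightarrow> bool" where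
  "abelian_subalgebra br H \<longleftrightarrow> subspace H \<and> (\<forall>X\<in>H. \<forall>Y\<in>H. br X Y = 0)"

definition hproj :: "'a::euclidean_space set \<Rightarrow> 'a \<Rightarrow> 'a" where
  "hproj H x = (THE y. y \<in> H \<and> (\<forall>z\<in>H. orthogonal (x - y) z))"

definition scaled_metric :: "'a::euclidean_space set \<Rightarrow> real \<Rightarrow> 'a \<Rightarrow> 'a \<Rightarrow> real" where
  "scaled_metric H lam X Y = inner (lam *\<^sub>R hproj H X + (X - hproj H X)) Y"

text \<open>Levi-Civita connection of the left-invariant metric g on left-invariant fields (Koszul formula).\<close>
definition lc_conn :: "('a \<Rightarrow> 'a \<Rightarrow> real) \<Rightarrow> ('a \<Rightarrow> 'a \<Rightarrow> 'a) \<Rightarrow> 'a \<Rightarrow> 'a \<Rightarrow> 'a" where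
  "lc_conn g br X Y = (THE W. \<forall>Z. g W Z = (g (br X Y) Z - g (br Y Z) X + g (br Z X) Y) / 2)"

definition curv :: "('a \<Rightarrow> 'a \<Rightarrow> real) \<Rightarrow> ('a::real_vector \<Rightarrow> 'a \<Rightarrow> 'a) \<Rightarrow> 'a \<Rightarrow> 'a \<Rightarrow> 'a \<Rightarrow> 'a" where
  "curv g br X Y Z = lc_conn g br X (lc_conn g br Y Z) - lc_conn g br Y (lc_conn g br X Z)
                      - lc_conn g br (br X Y) Z"

definition sectional_curvature :: "('a \<Rightarrow> 'a \<Rightarrow> real) \<Rightarrow> ('a::real_vector \<Rightarrow> 'a \<Rightarrow> 'a) \<Rightarrow> 'a \<Rightarrow> 'a \<Rightarrow> real" where
  "sectional_curvature g br X Y = g (curv g br X Y Y) X / (g X X * g Y Y - (g X Y)\<^sup>2)"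

definition nonneg_sectional_curvature :: "('a \<Rightarrow> 'a \<Rightarrow> real) \<Rightarrow> ('a::real_vector \<Rightarrow> 'a \<Rightarrow> 'a) \<Rightarrow> bool" where
  "nonneg_sectional_curvature g br \<longleftrightarrow>
     (\<forall>X Y. X \<noteq> Y \<and> \<not> dependent {X, Y} \<longrightarrow> sectional_curvature g br X Y \<ge> 0)"

definition derived_algebra :: "('a::real_vector \<Rightarrow> 'a \<Rightarrow> 'a) \<Rightarrow> 'a set" where
  "derived_algebra br = span {br X Y | X Y. True}"

end

theory Submission
  imports Defs
begin

text \<open>Write \<open>\<phi> = 1 + (\<lambda> - 1) P\<close> with \<open>P\<close> the projection onto \<open>h\<close>. Because \<open>h\<close> is abelian, the
  unnormalised sectional curvature of the plane spanned by \<open>X, Y\<close> equals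
  \<open>\<bar>Z\<bar>\<^sup>2 - 3/4 \<bar>Z\<bar>\<^sup>2\<close> (second norm with respect to \<open>h\<^sub>\<lambda>\<close>) for the single bracket \<open>Z = [\<phi> X, \<phi> Y]\<close>.
  As \<open>\<phi>\<close> is bijective, nonnegative curvature is the asserted inequality for all brackets \<open>Z\<close>, and
  it remains to see that every element of \<open>[g, g]\<close> is a bracket.

  For that, choose \<open>X\<close> whose centralizer \<open>t\<close> has minimal dimension, so that \<open>t\<close> is abelian, and
  move \<open>Z\<close> by isometric automorphisms until its projection \<open>H\<close> to \<open>t\<close> is as short as possible. The
  first variation gives \<open>[Z, H] = 0\<close>; summing the second variation over the directions
  \<open>W = [H, b]\<close>, \<open>b\<close> in an orthonormal basis, gives \<open>(ad H)\<^sup>2 = 0\<close> and then \<open>H = 0\<close>. Thus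
  \<open>Z\<close> is orthogonal to \<open>ker (ad X)\<close>, i.e. \<open>Z\<close> is in the range of the skew map \<open>ad X\<close>. No root
  decomposition is needed.\<close>

section \<open>Orthogonal projections\<close>

text \<open>Existence comes from the orthogonal decomposition; two candidates differ by a vector of
  \<open>S\<close> orthogonal to itself. So the description in \<open>hproj\<close> denotes.\<close>

lemma hproj_props:
  fixes x :: "'a::euclidean_space"
  assumes "subspace S"
  shows hproj_in: "hproj S x \<in> S"
    and inner_hproj_left: "z \<in> S \<Longrightarrow> inner (hproj S x) z = inner x z"
proof -
  have ex: "\<exists>!y. y \<in> S \<and> (\<forall>z\<in>S. orthogonal (x - y) z)"
  proof (rule ex_ex1I)
    obtain y z where "y \<in> span S" "\<And>w. w \<in> span S \<Longrightarrow> orthogonal z w" "x = y + z"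
      using orthogonal_subspace_decomp_exists by metis
    then show "\<exists>y. y \<in> S \<and> (\<forall>z\<in>S. orthogonal (x - y) z)"
      using assms by (intro exI[of _ y]) (auto simp: span_eq_iff[THEN iffD2] orthogonal_commute)
  next
    fix y y'
    assume y: "y \<in> S \<and> (\<forall>z\<in>S. orthogonal (x - y) z)"
      and y': "y' \<in> S \<and> (\<forall>z\<in>S. orthogonal (x - y') z)"
    have d: "y - y' \<in> S"
      using y y' assms subspace_diff by blast
    have "inner (y - y') (y - y') = inner (x - y') (y - y') - inner (x - y) (y - y')"
      by (simp add: inner_diff_left)
    also have "\<dots> = 0"
      using y y' d by (auto simp: orthogonal_def)
    finally show "y = y'"
      by simp
  qed
  have p: "hproj S x \<in> S \<and> (\<forall>z\<in>S. orthogonal (x - hproj S x) z)"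
    unfolding hproj_def by (rule theI'[OF ex])
  then show "hproj S x \<in> S" by blast
  show "inner (hproj S x) z = inner x z" if "z \<in> S"
    using p that by (auto simp: orthogonal_def inner_diff_left)
qed

lemma inner_hproj_right:
  assumes "subspace S" "z \<in> S"
  shows "inner z (hproj S x) = inner z x"
  using inner_hproj_left[OF assms] by (simp add: inner_commute)

lemma hproj_unique:
  assumes "subspace S" "y \<in> S" "\<And>z. z \<in> S \<Longrightarrow> inner y z = inner x z"
  shows "hproj S x = y"
proof -
  have "hproj S x - y \<in> S"
    using assms hproj_in subspace_diff by blast
  then have "inner (hproj S x - y) (hproj S x - y) = 0"
    using assms by (simp add: inner_diff_left inner_hproj_left)
  then show ?thesis by simp
qed

lemma hproj_id: "subspace S \<Longrightarrow> x \<in> S \<Longrightarrow> hproj S x = x"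
  by (rule hproj_unique) auto

lemma hproj_eq_0:
  assumes "subspace S" "\<And>z. z \<in> S \<Longrightarrow> inner x z = 0"
  shows "hproj S x = 0"
  by (rule hproj_unique) (use assms in \<open>auto simp: subspace_0\<close>)

lemma linear_hproj:
  assumes "subspace S"
  shows "linear (hproj S)"
proof (rule linearI)
  show "hproj S (x + y) = hproj S x + hproj S y" for x y
    using assms
    by (intro hproj_unique) (auto simp: hproj_in subspace_add inner_add_left inner_hproj_left)
  show "hproj S (c *\<^sub>R x) = c *\<^sub>R hproj S x" for c x
    using assms
    by (intro hproj_unique) (auto simp: hproj_in subspace_scale inner_hproj_left)
qed

section \<open>Linear flows and second-order minimality\<close>

text \<open>The solution is the series of \<open>exp (s T) v\<close>, differentiated coordinate by
  coordinate so that the theory of real power series applies.\<close>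

lemma linear_flow_exists:
  fixes T :: "'a::euclidean_space \<Rightarrow> 'a"
  assumes "bounded_linear T"
  shows "\<exists>y. y 0 = v \<and> (\<forall>s. (y has_vector_derivative T (y s)) (at s))"
proof -
  interpret T: bounded_linear T by fact
  obtain K where K: "K \<ge> 0" "\<And>x. norm (T x) \<le> norm x * K"
    using T.nonneg_bounded by blast
  have pow: "norm ((T ^^ n) v) \<le> K ^ n * norm v" for n
  proof (induction n)
    case (Suc n)
    have "norm ((T ^^ Suc n) v) \<le> norm ((T ^^ n) v) * K"
      using K by simp
    also have "\<dots> \<le> (K ^ n * norm v) * K"
      using Suc K by (intro mult_right_mono) auto
    finally show ?case by (simp add: algebra_simps)
  qed auto
  define t where "t s n = (s ^ n / fact n) *\<^sub>R (T ^^ n) v" for s :: real and n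
  have t: "summable (t s)" for s
  proof (rule summable_comparison_test)
    have "norm (t s n) \<le> (\<bar>s\<bar> * K) ^ n /\<^sub>R fact n * norm v" for n
    proof -
      have "norm (t s n) = \<bar>s\<bar> ^ n / fact n * norm ((T ^^ n) v)"
        by (simp add: t_def power_abs)
      also have "\<dots> \<le> \<bar>s\<bar> ^ n / fact n * (K ^ n * norm v)"
        by (intro mult_left_mono pow) auto
      finally show ?thesis
        by (simp add: power_mult_distrib field_simps)
    qed
    then show "\<exists>N. \<forall>n\<ge>N. norm (t s n) \<le> (\<bar>s\<bar> * K) ^ n /\<^sub>R fact n * norm v"
      by blast
    show "summable (\<lambda>n. (\<bar>s\<bar> * K) ^ n /\<^sub>R fact n * norm v)"
      by (intro summable_mult2 summable_exp_generic)
  qed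
  define y where "y s = (\<Sum>n. t s n)" for s
  have "y 0 = v"
  proof -
    have "t 0 = (\<lambda>n. if n = 0 then v else 0)"
      by (auto simp: t_def fun_eq_iff)
    then have "t 0 sums v"
      using sums_single[of 0 "\<lambda>_. v"] by simp
    then show ?thesis
      unfolding y_def by (rule sums_unique[symmetric])
  qed
  moreover have "(y has_vector_derivative T (y s)) (at s)" for s
    unfolding has_vector_derivative_def
  proof (subst has_derivative_componentwise_within, intro ballI)
    fix b :: 'a assume "b \<in> Basis"
    define c where "c n = inner ((T ^^ n) v) b / fact n" for n
    have cb: "inner (t r n) b = c n * r ^ n" for r n
      by (simp add: t_def c_def)
    have sm: "summable (\<lambda>n. c n * r ^ n)" for r
      using bounded_linear.summable[OF bounded_linear_inner_left t[of r], of b]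
      by (simp add: cb)
    have yb: "inner (y r) b = (\<Sum>n. c n * r ^ n)" for r
      unfolding y_def
      using bounded_linear.suminf[OF bounded_linear_inner_left t[of r], of b] by (simp add: cb)
    \<comment> \<open>Applying \<open>T\<close> shifts the series by one place; with the factorials
      this is termwise differentiation \<open>diffs\<close>.\<close>
    have db: "inner (T (t r n)) b = diffs c n * r ^ n" for r n
      by (simp add: t_def T.scaleR diffs_def c_def divide_simps)
    have Tb: "inner (T (y s)) b = (\<Sum>n. diffs c n * s ^ n)"
      unfolding y_def T.suminf[OF t]
      using bounded_linear.suminf[OF bounded_linear_inner_left T.summable[OF t[of s]], of b]
      by (simp add: db)
    have "((\<lambda>r. inner (y r) b) has_field_derivative inner (T (y s)) b) (at s)"
      unfolding yb Tb by (rule termdiffs_strong_converges_everywhere) (rule sm)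
    then show "((\<lambda>r. inner (y r) b) has_derivative (\<lambda>r. inner (r *\<^sub>R T (y s)) b)) (at s)"
      by (simp add: has_field_derivative_def mult_commute_abs)
  qed
  ultimately show ?thesis by blast
qed

text \<open>A negative \<open>D\<close> would make \<open>g'\<close> negative just to the right of
  the critical point 0, and the mean value theorem would give a value below
  \<open>g 0\<close>.\<close>

lemma second_derivative_nonneg_at_min:
  fixes g g' :: "real \<Rightarrow> real"
  assumes g: "\<And>s. (g has_real_derivative g' s) (at s)"
    and g2: "(g' has_real_derivative D) (at 0)"
    and min: "\<And>s. g 0 \<le> g s"
  shows "g' 0 = 0" "D \<ge> 0"
proof -
  show z: "g' 0 = 0"
    by (rule DERIV_local_min[OF g, of 1]) (use min in auto)
  show "D \<ge> 0"
  proof (rule ccontr)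
    assume "\<not> D \<ge> 0"
    then obtain d where d: "d > 0" "\<And>h. 0 < h \<Longrightarrow> h < d \<Longrightarrow> g' h < 0"
      using DERIV_neg_dec_right[OF g2] z by fastforce
    obtain x where "0 < x" "x < d / 2" "g (d / 2) - g 0 = (d / 2 - 0) * g' x"
      using MVT2[of 0 "d / 2" g g'] d g by auto
    moreover from this have "(d / 2 - 0) * g' x < 0"
      using d(1) d(2)[of x] by (intro mult_pos_neg) auto
    ultimately have "g (d / 2) < g 0"
      by linarith
    then show False
      using min[of "d / 2"] by simp
  qed
qed

section \<open>Every element of the derived algebra is a bracket\<close>

locale ad_invariant_lie_algebra =
  fixes br :: "'a::euclidean_space \<Rightarrow> 'a \<Rightarrow> 'a"
  assumes lie: "is_lie_bracket br" and ad_inv: "ad_invariant br"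
begin

sublocale br: bounded_bilinear br
  using lie by (simp add: is_lie_bracket_def bilinear_conv_bounded_bilinear)

lemma br_self [simp]: "br X X = 0"
  using lie by (simp add: is_lie_bracket_def)

lemma br_skew: "br X Y = - br Y X"
proof -
  have "br X Y + br Y X = br (X + Y) (X + Y)"
    unfolding br.add_left br.add_right by simp
  then show ?thesis
    by (simp add: eq_neg_iff_add_eq_0)
qed

lemma jacobi: "br X (br Y Z) = br (br X Y) Z + br Y (br X Z)"
proof -
  have "br X (br Y Z) + br Y (br Z X) + br Z (br X Y) = 0"
    using lie by (simp add: is_lie_bracket_def)
  moreover have "br Y (br Z X) = - br Y (br X Z)"
    by (metis br_skew br.minus_right)
  moreover have "br Z (br X Y) = - br (br X Y) Z"
    by (rule br_skew)
  ultimately show ?thesis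
    by (simp add: algebra_simps)
qed

lemma inner_br_left: "inner (br X Y) Z = - inner Y (br X Z)"
  using ad_inv by (simp add: ad_invariant_def)

lemma inner_br_assoc: "inner (br X Y) Z = inner X (br Y Z)"
  by (metis br_skew inner_br_left inner_minus_left minus_minus)

section \<open>Flows of ad W and isometric automorphisms\<close>

lemma ad_flow_norm_const:
  assumes "\<And>s. (y has_vector_derivative br W (y s)) (at s)"
  shows "norm (y s) = norm (y 0)"
proof -
  have "((\<lambda>s. inner (y s) (y s)) has_real_derivative 0) (at s)" for s
  proof -
    have "((\<lambda>s. inner (y s) (y s)) has_vector_derivative
        inner (y s) (br W (y s)) + inner (br W (y s)) (y s)) (at s)"
      by (rule bounded_bilinear.has_vector_derivative[OF bounded_bilinear_inner assms assms])
    moreover have "inner (y s) (br W (y s)) + inner (br W (y s)) (y s) = 0"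
      by (simp add: inner_br_left)
    ultimately show ?thesis
      by (simp add: has_real_derivative_iff_has_vector_derivative)
  qed
  then have "inner (y s) (y s) = inner (y 0) (y 0)"
    using DERIV_isconst_all by blast
  then show ?thesis
    by (simp add: norm_eq_sqrt_inner)
qed

text \<open>The difference of two solutions is again a solution, hence of constant norm, and starts
  at 0.\<close>

lemma ad_flow_unique:
  assumes "\<And>s. (y has_vector_derivative br W (y s)) (at s)"
    and "\<And>s. (z has_vector_derivative br W (z s)) (at s)"
    and "y 0 = z 0"
  shows "y s = z s"
proof -
  have "((\<lambda>s. y s - z s) has_vector_derivative br W (y s - z s)) (at s)" for s
    using has_vector_derivative_diff[OF assms(1,2)] by (simp add: br.diff_right)
  from ad_flow_norm_const[OF this] show ?thesis
    using assms(3) by simp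
qed

text \<open>Stands in for the adjoint group: closed conditions make compactness direct, and every
  \<open>exp (ad W)\<close> belongs to it.\<close>

definition isometric_auts :: "('a \<Rightarrow>\<^sub>L 'a) set" where
  "isometric_auts = {A :: 'a \<Rightarrow>\<^sub>L 'a. (\<forall>X. norm (A X) = norm X) \<and> (\<forall>X Y. br (A X) (A Y) = A (br X Y))}"

lemma compact_isometric_auts: "compact isometric_auts"
proof -
  have "bounded isometric_auts"
    unfolding bounded_iff
    by (rule exI[of _ 1]) (auto simp: isometric_auts_def intro!: norm_blinfun_bound)
  moreover have "closed isometric_auts"
  proof -
    have "closed {A :: 'a \<Rightarrow>\<^sub>L 'a. norm (A X) = norm X}" for X
      by (intro closed_Collect_eq continuous_intros)
    moreover have "closed {A :: 'a \<Rightarrow>\<^sub>L 'a. br (A X) (A Y) = A (br X Y)}" for X Y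
      by (intro closed_Collect_eq continuous_intros br.continuous_on)
    moreover have "isometric_auts = (\<Inter>X. {A :: 'a \<Rightarrow>\<^sub>L 'a. norm (A X) = norm X}) \<inter>
        (\<Inter>X. \<Inter>Y. {A :: 'a \<Rightarrow>\<^sub>L 'a. br (A X) (A Y) = A (br X Y)})"
      by (auto simp: isometric_auts_def)
    ultimately show ?thesis
      by (simp add: closed_INT closed_Int)
  qed
  ultimately show ?thesis
    by (simp add: compact_eq_bounded_closed)
qed

lemma isometric_auts_compose:
  "A \<in> isometric_auts \<Longrightarrow> B \<in> isometric_auts \<Longrightarrow> A o\<^sub>L B \<in> isometric_auts"
  by (auto simp: isometric_auts_def)

text \<open>The family \<open>E\<close> is \<open>s \<mapsto> exp (s ad W)\<close>; its linearity and its compatibility with the bracket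
  both come from uniqueness of the flow, since \<open>ad W\<close> is a derivation.\<close>

lemma ad_flow:
  obtains E :: "real \<Rightarrow> 'a \<Rightarrow>\<^sub>L 'a"
  where "\<And>s. E s \<in> isometric_auts" "\<And>v. E 0 v = v"
    "\<And>v s. ((\<lambda>s. E s v) has_vector_derivative br W (E s v)) (at s)"
proof -
  have "\<forall>v. \<exists>y. y 0 = v \<and> (\<forall>s. (y has_vector_derivative br W (y s)) (at s))"
    using linear_flow_exists[OF br.bounded_linear_right] by blast
  then obtain F where "\<forall>v. F v 0 = v \<and> (\<forall>s. (F v has_vector_derivative br W (F v s)) (at s))"
    by metis
  then have F0: "\<And>v. F v 0 = v"
    and F: "\<And>v s. (F v has_vector_derivative br W (F v s)) (at s)"
    by auto
  have nrm: "norm (F v s) = norm v" for v s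
    using ad_flow_norm_const[OF F, of v s] by (simp add: F0)
  have add: "F (u + v) s = F u s + F v s" for u v s
  proof (rule ad_flow_unique[OF F, of "\<lambda>s. F u s + F v s"])
    show "((\<lambda>s. F u s + F v s) has_vector_derivative br W (F u s + F v s)) (at s)" for s
      using has_vector_derivative_add[OF F F] by (simp add: br.add_right)
  qed (simp add: F0)
  have scale: "F (c *\<^sub>R v) s = c *\<^sub>R F v s" for c v s
  proof (rule ad_flow_unique[OF F, of "\<lambda>s. c *\<^sub>R F v s"])
    show "((\<lambda>s. c *\<^sub>R F v s) has_vector_derivative br W (c *\<^sub>R F v s)) (at s)" for s
      using bounded_linear.has_vector_derivative[OF bounded_linear_scaleR_right F]
      by (simp add: br.scaleR_right)
  qed (simp add: F0)
  have brk: "F (br u v) s = br (F u s) (F v s)" for u v s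
  proof (rule ad_flow_unique[OF F, of "\<lambda>s. br (F u s) (F v s)"])
    show "((\<lambda>s. br (F u s) (F v s)) has_vector_derivative br W (br (F u s) (F v s))) (at s)" for s
      using br.has_vector_derivative[OF F[of u s] F[of v s]]
      by (simp add: jacobi[of W] add.commute)
  qed (simp add: F0)
  have bl: "bounded_linear (\<lambda>v. F v s)" for s
    by (intro bounded_linear_intro[where K = 1]) (auto simp: add scale nrm)
  define E where "E s = Blinfun (\<lambda>v. F v s)" for s
  have E: "blinfun_apply (E s) v = F v s" for s v
    by (simp add: E_def bounded_linear_Blinfun_apply[OF bl])
  show thesis
    by (rule that[of E]) (auto simp: isometric_auts_def E nrm brk F0 F)
qed

section \<open>Centralizers and ranges of ad X\<close>

lemma subspace_centralizer: "subspace {U. br X U = 0}"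
  by (auto simp: subspace_def br.add_right br.scaleR_right br.zero_right)

text \<open>Minimality of the centralizer: perturbing \<open>X\<close> inside its centralizer \<open>C\<close> by a small multiple
  of \<open>Y\<close> keeps \<open>ad\<close> injective on the complement of \<open>C\<close>, hence cannot shrink \<open>C\<close> and \<open>Y\<close>
  centralizes \<open>C\<close>.\<close>

lemma exists_abelian_centralizer:
  obtains X where "\<And>Y U. br X Y = 0 \<Longrightarrow> br X U = 0 \<Longrightarrow> br Y U = 0"
proof -
  define C where "C X = {U. br X U = 0}" for X
  have sub: "subspace (C X)" for X
    unfolding C_def by (rule subspace_centralizer)
  obtain X where X: "\<And>Y. dim (C X) \<le> dim (C Y)"
    using ex_has_least_nat[of "\<lambda>_. True" undefined "\<lambda>X. dim (C X)"] by auto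
  define V where "V = {u. \<forall>z\<in>C X. inner u z = 0}"
  have subV: "subspace V"
    by (auto simp: V_def subspace_def inner_add_left)
  have CV: "u = 0" if "u \<in> C X" "u \<in> V" for u
    using that by (auto simp: V_def)
  have "\<exists>e>0. \<forall>x\<in>V. e * norm x \<le> norm (br X x)"
    by (rule injective_imp_isometric[OF closed_subspace[OF subV] subV br.bounded_linear_right])
       (use CV in \<open>auto simp: C_def\<close>)
  then obtain e where e: "e > 0" "\<And>x. x \<in> V \<Longrightarrow> e * norm x \<le> norm (br X x)"
    by blast
  have "br Y U = 0" if Y: "br X Y = 0" and U: "br X U = 0" for Y U
  proof -
    obtain K where K: "K > 0" "\<And>x. norm (br Y x) \<le> norm x * K"
      using bounded_linear.pos_bounded[OF br.bounded_linear_right] by blast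
    \<comment> \<open>So small that on \<open>V\<close> the perturbation, at most
      \<open>d * K * norm x\<close>, stays below the lower bound \<open>e * norm x\<close> for
      \<open>br X\<close>.\<close>
    define d where "d = e / (2 * K)"
    have d: "d > 0" "d * K < e"
      using e K by (auto simp: d_def)
    have XY: "br X (br Y u) = br Y (br X u)" for u
      using jacobi[of X Y u] Y by (simp add: br.zero_left)
    have "C (X + d *\<^sub>R Y) \<subseteq> C X \<inter> C Y"
    proof
      fix u assume u: "u \<in> C (X + d *\<^sub>R Y)"
      define u1 where "u1 = hproj (C X) u"
      define u2 where "u2 = u - u1"
      have u1: "br X u1 = 0"
        using hproj_in[OF sub, of X u] by (simp add: C_def u1_def)
      have u2: "u2 \<in> V"
        using inner_hproj_left[OF sub, of _ X u] by (auto simp: V_def u2_def u1_def inner_diff_left)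
      \<comment> \<open>The middle term lies in \<open>C X\<close>, the other two in its complement
        \<open>V\<close>, so both parts vanish separately.\<close>
      have eq: "br X u2 + d *\<^sub>R br Y u1 + d *\<^sub>R br Y u2 = 0"
        using u u1
        by (simp add: u2_def C_def br.add_left br.scaleR_left br.diff_right algebra_simps)
      have c: "br Y u1 \<in> C X"
        using XY[of u1] u1 by (simp add: C_def br.zero_right)
      have "br X u2 \<in> V"
        by (auto simp: V_def C_def inner_br_left)
      moreover have "br Y u2 \<in> V"
        using u2 XY by (auto simp: V_def C_def inner_br_left br.zero_right)
      ultimately have v: "br X u2 + d *\<^sub>R br Y u2 \<in> V"
        using subV by (simp add: subspace_add subspace_scale)
      have "d *\<^sub>R br Y u1 = - (br X u2 + d *\<^sub>R br Y u2)"
        using eq by (simp add: algebra_simps eq_neg_iff_add_eq_0)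
      then have "d *\<^sub>R br Y u1 \<in> V"
        using v subV subspace_neg by metis
      then have "d *\<^sub>R br Y u1 = 0"
        using c CV sub subspace_scale by blast
      then have Yu1: "br Y u1 = 0"
        using d by simp
      then have "br X u2 = - (d *\<^sub>R br Y u2)"
        using eq by (simp add: eq_neg_iff_add_eq_0)
      then have "e * norm u2 \<le> d * norm (br Y u2)"
        using e(2)[OF u2] d by simp
      also have "\<dots> \<le> d * (norm u2 * K)"
        using K d by (intro mult_left_mono) auto
      finally have "(e - d * K) * norm u2 \<le> 0"
        by (simp add: algebra_simps)
      then have "u2 = 0"
        using d(2) by (simp add: mult_le_0_iff)
      then show "u \<in> C X \<inter> C Y"
        using u1 Yu1 by (simp add: C_def u2_def)
    qed
    moreover from this have "C (X + d *\<^sub>R Y) = C X"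
      using X[of "X + d *\<^sub>R Y"] sub by (intro subspace_dim_equal) auto
    ultimately show ?thesis
      using U by (auto simp: C_def)
  qed
  then show thesis using that by blast
qed

text \<open>\<open>br X\<close> is skew, so the complement of its range is its kernel; the component
  \<open>D\<close> of \<open>Z\<close> outside the range is therefore orthogonal to \<open>Z\<close>
  and vanishes.\<close>

lemma orthogonal_centralizer_imp_br:
  assumes "\<And>U. br X U = 0 \<Longrightarrow> inner Z U = 0"
  shows "\<exists>Y. Z = br X Y"
proof -
  have R: "subspace (range (br X))"
    using br.bounded_linear_right bounded_linear.linear linear_subspace_image subspace_UNIV by blast
  define D where "D = Z - hproj (range (br X)) Z"
  have D: "inner D (br X U) = 0" for U
    using inner_hproj_left[OF R] by (simp add: D_def inner_diff_left)
  have "inner (br X D) (br X D) = 0"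
    by (simp add: inner_br_left D)
  then have "br X D = 0"
    by simp
  then have "inner Z D = 0"
    by (rule assms)
  moreover have "inner (hproj (range (br X)) Z) D = 0"
    using hproj_in[OF R, of Z] D by (auto simp: inner_commute)
  ultimately have "inner D D = 0"
    by (simp add: D_def inner_diff_left)
  then have "Z = hproj (range (br X)) Z"
    by (simp add: D_def)
  then show ?thesis
    using hproj_in[OF R, of Z] by auto
qed

text \<open>Invariance moves \<open>c\<close> into a bracket, which is zero. This serves to kill the
  minimal projection once it is known to be central.\<close>

lemma inner_derived_center:
  assumes "Z \<in> derived_algebra br" "\<And>U. br c U = 0"
  shows "inner Z c = 0"
  using assms(1) unfolding derived_algebra_def
proof (induction rule: span_induct)
  case base
  show ?case by (auto simp: subspace_def inner_add_left)
next
  case (step z)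
  then obtain X Y where z: "z = br X Y" by blast
  have "inner z c = - inner c (br Y X)"
    unfolding z by (metis br_skew inner_commute inner_minus_right)
  also have "\<dots> = 0"
    by (simp add: inner_br_assoc[symmetric] assms(2))
  finally show ?case .
qed

lemma isometric_aut_derived:
  assumes "A \<in> isometric_auts" "Z \<in> derived_algebra br"
  shows "A Z \<in> derived_algebra br"
  using assms(2) unfolding derived_algebra_def
proof (induction rule: span_induct)
  case base
  show ?case
    by (auto simp: subspace_def blinfun.add_right blinfun.scaleR_right blinfun.zero_right
        span_add span_scale span_0)
next
  case (step z)
  then obtain X Y where "z = br X Y" by blast
  then have "A z = br (A X) (A Y)"
    using assms(1) by (simp add: isometric_auts_def)
  then show ?case
    by (auto intro: span_base)
qed

text \<open>The invariant tensor \<open>\<Sum> b \<otimes> b\<close> is killed by the skew map \<open>ad T\<close>, and \<open>ad T\<close> commutes with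
  \<open>ad H\<close>.\<close>

lemma centralizer_casimir_contraction:
  assumes "br T H = 0"
  defines "N \<equiv> \<Sum>b\<in>Basis. br (br H (br H b)) (br H b)"
  shows "br T N = 0"
proof -
  have TH: "br T (br H u) = br H (br T u)" for u
    using jacobi[of T H u] assms(1) by (simp add: br.zero_left)
  define f where "f u v = br (br H (br H u)) (br H v)" for u v
  have f_sum_left: "f (\<Sum>c\<in>S. g c *\<^sub>R c) v = (\<Sum>c\<in>S. g c *\<^sub>R f c v)" for S g v
    unfolding f_def by (simp add: br.sum_left br.sum_right br.scaleR_left br.scaleR_right)
  have f_sum_right: "f u (\<Sum>c\<in>S. g c *\<^sub>R c) = (\<Sum>c\<in>S. g c *\<^sub>R f u c)" for S g u
    unfolding f_def by (simp add: br.sum_left br.sum_right br.scaleR_left br.scaleR_right)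
  have "br T N = (\<Sum>b\<in>Basis. f (br T b) b + f b (br T b))"
    unfolding N_def br.sum_right f_def
    by (intro sum.cong refl) (metis jacobi TH)
  also have "\<dots> = (\<Sum>b\<in>Basis. f (br T b) b) + (\<Sum>b\<in>Basis. f b (br T b))"
    by (rule sum.distrib)
  also have "(\<Sum>b\<in>Basis. f (br T b) b) = (\<Sum>b\<in>Basis. \<Sum>c\<in>Basis. inner (br T b) c *\<^sub>R f c b)"
    by (intro sum.cong refl) (metis f_sum_left euclidean_representation)
  also have "\<dots> = (\<Sum>c\<in>Basis. \<Sum>b\<in>Basis. inner (br T b) c *\<^sub>R f c b)"
    by (rule sum.swap)
  \<comment> \<open>The matrix of \<open>br T\<close> is antisymmetric, so the two double sums
    cancel.\<close>
  also have "\<dots> = (\<Sum>c\<in>Basis. \<Sum>b\<in>Basis. - (inner (br T c) b *\<^sub>R f c b))"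
    by (intro sum.cong refl) (metis inner_br_left inner_commute scaleR_minus_left)
  also have "(\<Sum>b\<in>Basis. f b (br T b)) = (\<Sum>b\<in>Basis. \<Sum>c\<in>Basis. inner (br T b) c *\<^sub>R f b c)"
    by (intro sum.cong refl) (metis f_sum_right euclidean_representation)
  finally show ?thesis
    by (simp add: sum_negf)
qed

theorem derived_algebra_eq_brackets:
  assumes "Z \<in> derived_algebra br"
  shows "\<exists>X Y. Z = br X Y"
proof -
  obtain X0 where X0: "\<And>Y U. br X0 Y = 0 \<Longrightarrow> br X0 U = 0 \<Longrightarrow> br Y U = 0"
    using exists_abelian_centralizer by blast
  define t where "t = {U. br X0 U = 0}"
  have t: "subspace t"
    unfolding t_def by (rule subspace_centralizer)
  define P where "P = hproj t"
  have P: "bounded_linear P"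
    unfolding P_def using linear_hproj[OF t] by (simp add: linear_conv_bounded_linear)
  have "\<exists>A\<in>isometric_auts. \<forall>B\<in>isometric_auts. inner (P (A Z)) (P (A Z)) \<le> inner (P (B Z)) (P (B Z))"
  proof (rule continuous_attains_inf[OF compact_isometric_auts])
    have "id_blinfun \<in> isometric_auts"
      by (simp add: isometric_auts_def)
    then show "isometric_auts \<noteq> {}" by blast
    show "continuous_on isometric_auts (\<lambda>A. inner (P (blinfun_apply A Z)) (P (blinfun_apply A Z)))"
      by (intro continuous_intros bounded_linear.continuous_on[OF P])
  qed
  then obtain A where A: "A \<in> isometric_auts"
    and min: "\<And>B. B \<in> isometric_auts \<Longrightarrow> inner (P (A Z)) (P (A Z)) \<le> inner (P (B Z)) (P (B Z))"
    by blast
  define Z' where "Z' = A Z"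
  define H where "H = P Z'"
  have Ht: "H \<in> t"
    unfolding H_def P_def by (rule hproj_in[OF t])
  have HT: "inner H T = inner Z' T" if "T \<in> t" for T
    unfolding H_def P_def using t that by (rule inner_hproj_left)
  \<comment> \<open>These are half the first and second derivatives at 0 of the squared length of
    \<open>P (E s Z')\<close>; 0 is a minimum because \<open>E s o\<^sub>L A\<close> competes with
    \<open>A\<close>.\<close>
  have first: "inner H (br W Z') = 0"
    and second: "0 \<le> inner (P (br W Z')) (br W Z') + inner H (br W (br W Z'))" for W
  proof -
    obtain E where E: "\<And>s. E s \<in> isometric_auts" "\<And>v. blinfun_apply (E 0) v = v"
      "\<And>v s. ((\<lambda>s. blinfun_apply (E s) v) has_vector_derivative br W (E s v)) (at s)"
      using ad_flow by blast
    define y where "y s = E s Z'" for s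
    have y0: "y 0 = Z'"
      by (simp add: y_def E)
    have y: "(y has_vector_derivative br W (y s)) (at s)" for s
      unfolding y_def by (rule E)
    have Py: "((\<lambda>s. P (y s)) has_vector_derivative P (br W (y s))) (at s)" for s
      by (rule bounded_linear.has_vector_derivative[OF P y])
    have Wy: "((\<lambda>s. br W (y s)) has_vector_derivative br W (br W (y s))) (at s)" for s
      by (rule bounded_linear.has_vector_derivative[OF br.bounded_linear_right y])
    have PP: "inner (P u) (P v) = inner (P u) v" for u v
      unfolding P_def by (rule inner_hproj_right[OF t hproj_in[OF t]])
    define g where "g s = inner (P (y s)) (P (y s))" for s
    define g' where "g' s = 2 * inner (P (y s)) (br W (y s))" for s
    define D where "D = 2 * (inner (P (y 0)) (br W (br W (y 0))) + inner (P (br W (y 0))) (br W (y 0)))"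
    have PP': "inner (P u) (P v) + inner (P v) (P u) = 2 * inner (P u) v" for u v
      using PP[of u v] inner_commute[of "P u" "P v"] by simp
    have g: "(g has_real_derivative g' s) (at s)" for s
      using bounded_bilinear.has_vector_derivative[OF bounded_bilinear_inner Py[of s] Py[of s]]
      unfolding g_def g'_def has_real_derivative_iff_has_vector_derivative
      unfolding PP' .
    have g': "(g' has_real_derivative D) (at 0)"
      unfolding g'_def D_def has_real_derivative_iff_has_vector_derivative
      by (rule bounded_linear.has_vector_derivative[OF bounded_linear_mult_right
            bounded_bilinear.has_vector_derivative[OF bounded_bilinear_inner Py Wy]])
    have m: "g 0 \<le> g s" for s
      using min[OF isometric_auts_compose[OF E(1) A], of s]
      by (simp add: g_def y_def E Z'_def)
    show "inner H (br W Z') = 0"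
      using second_derivative_nonneg_at_min(1)[OF g g' m] by (simp add: g'_def y0 H_def)
    show "0 \<le> inner (P (br W Z')) (br W Z') + inner H (br W (br W Z'))"
      using second_derivative_nonneg_at_min(2)[OF g g' m] by (simp add: D_def y0 H_def)
  qed
  have ZH: "br Z' H = 0"
  proof -
    have "inner W (br Z' H) = 0" for W
      using first[of W] inner_br_assoc[of W Z' H] by (simp add: inner_commute)
    then show ?thesis
      using inner_eq_zero_iff by blast
  qed
  have tH: "br T H = 0" if "T \<in> t" for T
    using X0 that Ht by (simp add: t_def)
  have Z'H: "inner Z' (br H U) = 0" for U
    using ZH by (simp add: inner_br_assoc[symmetric])
  define N where "N = (\<Sum>b\<in>Basis. br (br H (br H b)) (br H b))"
  \<comment> \<open>Membership in \<open>t\<close> lets \<open>Z'\<close> be replaced by its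
    projection \<open>H\<close> in the pairing with \<open>N\<close>.\<close>
  have Nt: "N \<in> t"
  proof -
    have "X0 \<in> t"
      by (simp add: t_def)
    then show ?thesis
      using centralizer_casimir_contraction[OF tH, of X0] by (simp add: t_def N_def)
  qed
  \<comment> \<open>For \<open>W = br H b\<close> the square term of the second variation drops out:
    bracketing \<open>W\<close> with \<open>t\<close> stays in the range of \<open>br H\<close>,
    which is orthogonal to \<open>Z'\<close>.\<close>
  have summand: "0 \<le> inner (br (br H W) W) Z'" if "W = br H b" for W b
  proof -
    have "P (br W Z') = 0"
      unfolding P_def
    proof (rule hproj_eq_0[OF t])
      fix T assume T: "T \<in> t"
      have "br W T = - br H (br T b)"
        using jacobi[of T H b] tH[OF T] br_skew[of W T] that by (simp add: br.zero_left)
      then show "inner (br W Z') T = 0"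
        by (simp add: inner_br_left Z'H)
    qed
    moreover have "inner H (br W (br W Z')) = inner (br (br H W) W) Z'"
      by (simp add: inner_br_assoc)
    ultimately show ?thesis
      using second[of W] by (simp add: inner_commute br.zero_left)
  qed
  have "0 \<le> (\<Sum>b\<in>Basis. inner (br (br H (br H b)) (br H b)) Z')"
    by (intro sum_nonneg summand) simp
  also have "\<dots> = inner N H"
    using HT[OF Nt] by (simp add: N_def inner_sum_left inner_sum_right inner_commute)
  \<comment> \<open>The sum, nonnegative by the second variation, is also minus a sum of squares, so
    every square is zero.\<close>
  also have "\<dots> = (\<Sum>b\<in>Basis. - inner (br H (br H b)) (br H (br H b)))"
    unfolding N_def inner_sum_left
    by (intro sum.cong refl) (metis br_skew inner_br_assoc inner_minus_right)
  finally have le: "(\<Sum>b\<in>Basis. inner (br H (br H b)) (br H (br H b))) \<le> 0"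
    by (simp add: sum_negf)
  have HHb: "br H (br H b) = 0" if "b \<in> Basis" for b
  proof -
    have "inner (br H (br H b)) (br H (br H b)) \<le> (\<Sum>b\<in>Basis. inner (br H (br H b)) (br H (br H b)))"
      using that by (intro member_le_sum) auto
    then show ?thesis
      using le by (meson inner_eq_zero_iff inner_ge_zero order_antisym order_trans)
  qed
  \<comment> \<open>A skew map whose square vanishes is zero.\<close>
  have "br H b = 0" if "b \<in> Basis" for b
    using inner_br_left[of H b "br H b"] HHb[OF that] by simp
  then have "br H U = 0" for U
    by (rule linear_eq_0_on_span[OF bounded_linear.linear[OF br.bounded_linear_right]]) auto
  then have "inner Z' H = 0"
    using inner_derived_center isometric_aut_derived[OF A assms] by (simp add: Z'_def)
  then have "H = 0"
    using HT[OF Ht] by simp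
  then have "inner Z' U = 0" if "br X0 U = 0" for U
    using HT[of U] that by (simp add: t_def)
  then obtain Y where Y: "Z' = br X0 Y"
    using orthogonal_centralizer_imp_br by blast
  \<comment> \<open>The bracket found for \<open>A Z\<close> is pulled back along the bijective
    automorphism \<open>A\<close>.\<close>
  have nrmA: "norm (A u) = norm u" and brA: "br (A u) (A v) = A (br u v)" for u v
    using A by (auto simp: isometric_auts_def)
  have linA: "linear (blinfun_apply A)"
    using blinfun.bounded_linear_right bounded_linear.linear by blast
  have injA: "inj (blinfun_apply A)"
    unfolding linear_injective_0[OF linA] using nrmA by (metis norm_eq_zero)
  then have "surj (blinfun_apply A)"
    using linear_injective_imp_surjective[OF linA] by blast
  then obtain u v where "X0 = A u" "Y = A v"
    by (metis surjD)
  then have "A Z = A (br u v)"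
    using Y by (simp add: Z'_def brA)
  then show ?thesis
    using injA by (metis injD)
qed

end

section \<open>Curvature of the scaled metric\<close>

locale scaled_lie_algebra = ad_invariant_lie_algebra br
  for br :: "'a::euclidean_space \<Rightarrow> 'a \<Rightarrow> 'a" +
  fixes H :: "'a set" and lam :: real
  assumes abelian: "abelian_subalgebra br H" and lam_pos: "lam > 0"
begin

abbreviation P where "P \<equiv> hproj H"
abbreviation g where "g \<equiv> scaled_metric H lam"

definition phi :: "'a \<Rightarrow> 'a" where
  "phi X = X + (lam - 1) *\<^sub>R P X"

lemma subspace_H: "subspace H"
  using abelian by (simp add: abelian_subalgebra_def)

lemma br_P_P [simp]: "br (P X) (P Y) = 0"
  using abelian hproj_in[OF subspace_H] by (auto simp: abelian_subalgebra_def)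

lemma P_in [simp]: "P X \<in> H"
  by (rule hproj_in[OF subspace_H])

lemma P_add: "P (X + Y) = P X + P Y"
  and P_diff: "P (X - Y) = P X - P Y"
  and P_scale: "P (c *\<^sub>R X) = c *\<^sub>R P X"
  and P_P [simp]: "P (P X) = P X"
  using linear_hproj[OF subspace_H]
  by (simp_all add: linear_add linear_diff linear_scale hproj_id[OF subspace_H])

lemma g_phi: "g X Y = inner (phi X) Y"
  by (simp add: scaled_metric_def phi_def algebra_simps)

lemma g_eq: "g X Y = inner X Y + (lam - 1) * inner (P X) (P Y)"
proof -
  have "inner (P X) Y = inner (P X) (P Y)"
    by (simp add: inner_hproj_right[OF subspace_H])
  then show ?thesis
    by (simp add: g_phi phi_def inner_add_left)
qed

lemma bilinear_g: "bilinear g"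
  unfolding bilinear_def
  by (auto intro!: linearI simp: g_eq P_add P_scale inner_add_left inner_add_right algebra_simps)

lemmas g_simps = bilinear_ladd[OF bilinear_g] bilinear_radd[OF bilinear_g]
  bilinear_lmul[OF bilinear_g] bilinear_rmul[OF bilinear_g]
  bilinear_lsub[OF bilinear_g] bilinear_rsub[OF bilinear_g]
  bilinear_lneg[OF bilinear_g] bilinear_rneg[OF bilinear_g]

lemma g_commute: "g X Y = g Y X"
  by (simp add: g_eq inner_commute)

lemma inner_P_self_le: "inner (P X) (P X) \<le> inner X X"
proof -
  have "inner (P X) X = inner (P X) (P X)"
    by (simp add: inner_hproj_right[OF subspace_H])
  then have "inner (X - P X) (X - P X) = inner X X - inner (P X) (P X)"
    by (simp add: inner_diff_left inner_diff_right inner_commute[of X "P X"])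
  then show ?thesis
    using inner_ge_zero[of "X - P X"] by linarith
qed

lemma g_pos: "X \<noteq> 0 \<Longrightarrow> 0 < g X X"
proof -
  assume "X \<noteq> 0"
  then have X: "0 < inner X X" by simp
  show ?thesis
  proof (cases "inner (P X) (P X) = 0")
    case True
    then show ?thesis using X by (simp add: g_eq)
  next
    case False
    then have "0 < lam * inner (P X) (P X)"
      using lam_pos by (simp del: inner_eq_zero_iff inner_gt_zero_iff add: order_less_le)
    then show ?thesis
      using inner_P_self_le[of X] unfolding g_eq by (simp add: algebra_simps)
  qed
qed

text \<open>Cauchy-Schwarz for \<open>g\<close> with its equality case; it fixes the sign of the
  denominator of the sectional curvature.\<close>

lemma gram_nonneg: "0 \<le> g X X * g Y Y - (g X Y)\<^sup>2"
  and gram_eq_0: "g X X * g Y Y - (g X Y)\<^sup>2 = 0 \<Longrightarrow> X = Y \<or> dependent {X, Y}"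
proof -
  \<comment> \<open>The component of \<open>X\<close> that is \<open>g\<close>-orthogonal to
    \<open>Y\<close>, multiplied by \<open>g Y Y\<close> to avoid division.\<close>
  define D where "D = g Y Y *\<^sub>R X - g X Y *\<^sub>R Y"
  have D: "g D D = g Y Y * (g X X * g Y Y - (g X Y)\<^sup>2)"
    by (simp add: D_def g_simps g_commute[of Y X] power2_eq_square algebra_simps)
  show "0 \<le> g X X * g Y Y - (g X Y)\<^sup>2"
  proof (cases "Y = 0")
    case True
    then show ?thesis by (simp add: g_eq linear_0[OF linear_hproj[OF subspace_H]])
  next
    case False
    have "0 \<le> g D D"
      using g_pos[of D] by (cases "D = 0") (auto simp: g_eq linear_0[OF linear_hproj[OF subspace_H]])
    then show ?thesis
      using D g_pos[OF False] by (simp add: zero_le_mult_iff)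
  qed
  assume z: "g X X * g Y Y - (g X Y)\<^sup>2 = 0"
  show "X = Y \<or> dependent {X, Y}"
  proof (cases "Y = 0")
    case True
    then show ?thesis by (simp add: dependent_zero)
  next
    case False
    have "D = 0"
      using D z g_pos[of D] by fastforce
    then have "g Y Y *\<^sub>R X = g X Y *\<^sub>R Y"
      by (simp add: D_def)
    then have "X = (g X Y / g Y Y) *\<^sub>R Y"
      using g_pos[OF False] by (simp add: eq_vector_fraction_iff)
    then have "X \<in> span {Y}"
      by (metis span_base span_scale singletonI)
    moreover have "{X, Y} - {X} = {Y}" if "X \<noteq> Y"
      using that by blast
    ultimately show ?thesis
      unfolding dependent_def by (metis insertI1)
  qed
qed

section \<open>Levi-Civita connection and curvature numerator\<close>

lemma g_left_cancel: "(\<And>Z. g W Z = g W' Z) \<Longrightarrow> W = W'"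
  using g_pos[of "W - W'"] by (force simp: g_simps)

text \<open>On these brackets \<open>\<phi>\<close> is the identity, which is why no \<open>\<phi>\<inverse>\<close> appears in the connection
  below.\<close>

lemma P_br_P [simp]: "P (br (P A) X) = 0" "P (br X (P A)) = 0"
proof -
  show 1: "P (br (P A) X) = 0"
  proof (rule hproj_eq_0[OF subspace_H])
    fix z assume "z \<in> H"
    then have "br (P A) z = 0"
      using abelian by (simp add: abelian_subalgebra_def)
    then show "inner (br (P A) X) z = 0"
      by (simp add: inner_br_left)
  qed
  have "P (br X (P A)) = (- 1) *\<^sub>R P (br (P A) X)"
    using br_skew[of X "P A"] P_scale[of "-1" "br (P A) X"] by simp
  then show "P (br X (P A)) = 0"
    by (simp add: 1)
qed

text \<open>Half the bracket is the connection of the bi-invariant metric; the rest is the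
  correction forced by the Koszul formula.\<close>

definition conn :: "'a \<Rightarrow> 'a \<Rightarrow> 'a" where
  "conn X Y = (1 / 2) *\<^sub>R (br X Y + (lam - 1) *\<^sub>R (br X (P Y) - br (P X) Y))"

lemma koszul: "g (conn X Y) Z = (g (br X Y) Z - g (br Y Z) X + g (br Z X) Y) / 2"
proof -
  have 1: "g (br Y Z) X = inner (br X Y) Z + (lam - 1) * inner (br (P X) Y) Z"
  proof -
    have "g (br Y Z) X = inner (br (phi X) Y) Z"
      by (metis g_commute g_phi inner_br_assoc)
    then show ?thesis
      by (simp only: phi_def br.add_left br.scaleR_left inner_add_left inner_scaleR_left)
  qed
  have 2: "g (br Z X) Y = inner (br X Y) Z + (lam - 1) * inner (br X (P Y)) Z"
  proof -
    have "g (br Z X) Y = inner (br X (phi Y)) Z"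
      by (metis g_commute g_phi inner_br_assoc inner_commute)
    then show ?thesis
      by (simp only: phi_def br.add_right br.scaleR_right inner_add_left inner_scaleR_left)
  qed
  have 3: "g (conn X Y) Z =
      (g (br X Y) Z + (lam - 1) * (inner (br X (P Y)) Z - inner (br (P X) Y) Z)) / 2"
    by (simp add: g_eq conn_def P_add P_diff P_scale inner_add_left inner_diff_left add_divide_distrib)
  show ?thesis
    unfolding 1 2 3 by (simp add: algebra_simps)
qed

lemma lc_conn_eq: "lc_conn g br X Y = conn X Y"
  unfolding lc_conn_def
proof (rule the_equality)
  show "\<forall>Z. g (conn X Y) Z = (g (br X Y) Z - g (br Y Z) X + g (br Z X) Y) / 2"
    by (simp add: koszul)
qed (auto intro: g_left_cancel simp: koszul)

text \<open>Metric compatibility on left-invariant fields, whose inner products are constant: the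
  Koszul expression is antisymmetric in \<open>U\<close> and \<open>V\<close>.\<close>

lemma conn_compatible: "g (conn X U) V = - g U (conn X V)"
proof -
  have "g (br U V) X = - g (br V U) X" "g (br X V) U = - g (br V X) U" "g (br X U) V = - g (br U X) V"
    by (metis br_skew bilinear_lneg[OF bilinear_g])+
  then have "g (br X U) V - g (br U V) X + g (br V X) U =
      - (g (br X V) U - g (br V U) X + g (br U X) V)"
    by simp
  then show ?thesis
    unfolding koszul g_commute[of U "conn X V"] minus_divide_left by (simp only:)
qed

text \<open>With \<open>S = [X, b] + [a, Y]\<close>, where \<open>a\<close> and \<open>b\<close> are the \<open>h\<close>-parts of \<open>X\<close> and \<open>Y\<close>, the
  numerator is \<open>\<bar>[X, Y] + \<mu> S\<bar>\<^sup>2 / 4 - 3/4 \<mu> \<bar>P [X, Y]\<bar>\<^sup>2\<close> with \<open>\<mu> = \<lambda> - 1\<close>, and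
  \<open>[\<phi> X, \<phi> Y] = [X, Y] + \<mu> S\<close> because \<open>h\<close> is abelian.\<close>

lemma curv_numerator:
  "g (curv g br X Y Y) X =
    inner (br (phi X) (phi Y)) (br (phi X) (phi Y))
    - 3 / 4 * g (br (phi X) (phi Y)) (br (phi X) (phi Y))"
proof -
  define m where "m = lam - 1"
  define C where "C = br X Y"
  define u where "u = br X (P Y)"
  define v where "v = br (P X) Y"
  have Puv [simp]: "P u = 0" "P v = 0"
    by (simp_all add: u_def v_def)
  have phi: "phi Z = Z + m *\<^sub>R P Z" for Z
    by (simp add: phi_def m_def)
  have Zeq: "br (phi X) (phi Y) = C + m *\<^sub>R (u + v)"
    by (simp add: phi br.add_left br.add_right br.scaleR_left br.scaleR_right C_def u_def v_def
        scaleR_add_right)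
  have PZ: "P (br (phi X) (phi Y)) = P C"
    unfolding Zeq by (simp add: P_add P_scale)
  \<comment> \<open>Jacobi together with \<open>br (P X) (P Y) = 0\<close> turns this product into
    one of the mixed brackets.\<close>
  have uv: "inner (br X (P X)) (br Y (P Y)) = - inner u v"
  proof -
    have "br (P X) (br Y (P Y)) = br v (P Y)"
      using jacobi[of "P X" Y "P Y"] by (simp add: v_def br.zero_right)
    then have "inner (br X (P X)) (br Y (P Y)) = inner X (br v (P Y))"
      by (simp add: inner_br_assoc)
    also have "\<dots> = - inner X (br (P Y) v)"
      by (subst br_skew) simp
    also have "\<dots> = - inner u v"
      by (simp add: u_def inner_br_assoc)
    finally show ?thesis .
  qed
  have cXX: "conn Z Z = m *\<^sub>R br Z (P Z)" for Z
    by (simp add: conn_def m_def br_skew[of "P Z" Z] scaleR_2[symmetric])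
  have cXY: "conn X Y = (1 / 2) *\<^sub>R (C + m *\<^sub>R (u - v))"
    by (simp add: conn_def m_def C_def u_def v_def)
  have cYX: "conn Y X = (1 / 2) *\<^sub>R (- C + m *\<^sub>R (u - v))"
    using br_skew[of Y X] br_skew[of Y "P X"] br_skew[of "P Y" X]
    by (simp add: conn_def m_def C_def u_def v_def)
  \<comment> \<open>Compatibility moves the outer connection onto \<open>X\<close>, here and in
    \<open>t2\<close>, so no iterated connection has to be expanded.\<close>
  have t1: "g (conn X (conn Y Y)) X = m\<^sup>2 * inner u v"
    unfolding conn_compatible[of X "conn Y Y" X] unfolding cXX using uv
    by (simp add: g_eq P_scale inner_commute[of "br Y (P Y)"] power2_eq_square)
  have t2: "g (conn Y (conn X Y)) X = g C C / 4 - m\<^sup>2 / 4 * inner (u - v) (u - v)"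
  proof -
    have P: "P (- C + m *\<^sub>R (u - v)) = - P C" "P (C + m *\<^sub>R (u - v)) = P C"
      by (simp_all add: P_add P_diff P_scale linear_neg[OF linear_hproj[OF subspace_H]])
    define d where "d = m *\<^sub>R (u - v)"
    have "g (conn Y (conn X Y)) X = - (g (C + d) (- C + d) / 4)"
      unfolding conn_compatible[of Y "conn X Y" X] cYX unfolding cXY d_def
      by (simp add: bilinear_lmul[OF bilinear_g] bilinear_rmul[OF bilinear_g])
    also have "g (C + d) (- C + d) = inner d d - g C C"
      unfolding g_eq P d_def[symmetric] P[folded d_def]
      by (simp add: m_def inner_add_left inner_add_right inner_diff_right inner_commute[of d C])
    also have "inner d d = m\<^sup>2 * inner (u - v) (u - v)"
      by (simp add: d_def power2_eq_square)
    finally show ?thesis by (simp add: diff_divide_distrib)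
  qed
  \<comment> \<open>Here the Koszul formula is used directly; invariance turns each of its terms
    into a pairing with \<open>C\<close>.\<close>
  have t3: "g (conn C Y) X = (g C C - inner C (2 *\<^sub>R C + m *\<^sub>R (u + v))) / 2"
  proof -
    have "g (br C Y) X = - inner C (br (phi X) Y)"
      by (metis g_commute g_phi br_skew inner_br_assoc inner_commute inner_minus_right)
    moreover have "g (br X C) Y = - inner C (br X (phi Y))"
      by (metis g_commute g_phi inner_br_left inner_commute)
    moreover have "g (br Y X) C = - g C C"
      using br_skew[of Y X] by (simp add: C_def g_simps)
    moreover have "br (phi X) Y + br X (phi Y) = 2 *\<^sub>R C + m *\<^sub>R (u + v)"
      by (simp add: phi br.add_left br.add_right br.scaleR_left br.scaleR_right C_def u_def v_def
          scaleR_add_right scaleR_2)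
    then have "inner C (br (phi X) Y) + inner C (br X (phi Y)) = inner C (2 *\<^sub>R C + m *\<^sub>R (u + v))"
      by (simp only: inner_add_right[symmetric])
    ultimately have "g (br C Y) X - g (br Y X) C + g (br X C) Y =
        g C C - inner C (2 *\<^sub>R C + m *\<^sub>R (u + v))"
      by linarith
    then show ?thesis
      unfolding koszul by (simp only:)
  qed
  have "g (curv g br X Y Y) X = m\<^sup>2 * inner u v - (g C C / 4 - m\<^sup>2 / 4 * inner (u - v) (u - v))
      - (g C C - inner C (2 *\<^sub>R C + m *\<^sub>R (u + v))) / 2"
    unfolding curv_def lc_conn_eq g_simps t1 t2 using t3 by (simp add: C_def)
  moreover have gC: "g C C = inner C C + m * inner (P C) (P C)"
    by (simp add: g_eq m_def)
  moreover have "g (br (phi X) (phi Y)) (br (phi X) (phi Y)) =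
      inner (C + m *\<^sub>R (u + v)) (C + m *\<^sub>R (u + v)) + m * inner (P C) (P C)"
    unfolding g_eq PZ unfolding Zeq m_def ..
  ultimately show ?thesis
    unfolding Zeq
    by (simp add: inner_add_left inner_add_right inner_diff_left inner_diff_right
        inner_commute[of v u] inner_commute[of u C] inner_commute[of v C]
        power2_eq_square algebra_simps add_divide_distrib diff_divide_distrib)
qed

section \<open>From planes to brackets\<close>

lemma phi_surj: "\<exists>X. phi X = Y"
proof
  \<comment> \<open>The inverse of \<open>phi\<close> divides the part in \<open>H\<close> by
    \<open>lam\<close> and fixes the complement.\<close>
  show "phi (Y + (1 / lam - 1) *\<^sub>R P Y) = Y"
    using lam_pos
    by (simp add: phi_def P_add P_scale scaleR_add_left[symmetric] scaleR_left_diff_distrib[symmetric] field_simps)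
qed

lemma phi_scale: "phi (c *\<^sub>R X) = c *\<^sub>R phi X"
  by (simp add: phi_def P_scale algebra_simps)

theorem nonneg_sectional_curvature_iff_br:
  "nonneg_sectional_curvature g br \<longleftrightarrow> (\<forall>X Y. g (br X Y) (br X Y) \<le> 4 / 3 * inner (br X Y) (br X Y))"
proof
  assume nn: "nonneg_sectional_curvature g br"
  show "\<forall>X Y. g (br X Y) (br X Y) \<le> 4 / 3 * inner (br X Y) (br X Y)"
  proof (intro allI)
    fix X' Y'
    obtain X Y where XY: "X' = phi X" "Y' = phi Y"
      using phi_surj by metis
    show "g (br X' Y') (br X' Y') \<le> 4 / 3 * inner (br X' Y') (br X' Y')"
    proof (cases "X \<noteq> Y \<and> \<not> dependent {X, Y}")
      case True
      then have "0 < g X X * g Y Y - (g X Y)\<^sup>2"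
        using gram_nonneg[of X Y] gram_eq_0[of X Y] by linarith
      moreover have "0 \<le> g (curv g br X Y Y) X / (g X X * g Y Y - (g X Y)\<^sup>2)"
        using nn True by (auto simp: nonneg_sectional_curvature_def sectional_curvature_def)
      ultimately have "0 \<le> g (curv g br X Y Y) X"
        by (simp add: zero_le_divide_iff)
      then show ?thesis
        unfolding XY curv_numerator by simp
    next
      case False
      \<comment> \<open>Dependent pairs span no plane, but linearity of \<open>phi\<close> makes
        their bracket vanish.\<close>
      then have "X = Y \<or> (\<exists>c. X = c *\<^sub>R Y) \<or> (\<exists>c. Y = c *\<^sub>R X)"
        by (auto simp: dependent_def span_singleton insert_Diff_if split: if_splits)
      then have "br X' Y' = 0"
        unfolding XY by (auto simp: phi_scale br.scaleR_left br.scaleR_right)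
      then show ?thesis
        by (simp add: g_eq linear_0[OF linear_hproj[OF subspace_H]])
    qed
  qed
next
  assume le: "\<forall>X Y. g (br X Y) (br X Y) \<le> 4 / 3 * inner (br X Y) (br X Y)"
  have "0 \<le> g (curv g br X Y Y) X" for X Y
    unfolding curv_numerator using le[rule_format, of "phi X" "phi Y"] by simp
  then show "nonneg_sectional_curvature g br"
    unfolding nonneg_sectional_curvature_def sectional_curvature_def
    using gram_nonneg by (simp add: divide_nonneg_nonneg)
qed

end

theorem mainTheorem8:
  fixes br :: "'a::euclidean_space \<Rightarrow> 'a \<Rightarrow> 'a" and H :: "'a set" and lam :: real
  assumes "is_lie_bracket br" and "ad_invariant br" and "abelian_subalgebra br H" and "lam > 0"
  shows "nonneg_sectional_curvature (scaled_metric H lam) br \<longleftrightarrow>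
         (\<forall>Z\<in>derived_algebra br. scaled_metric H lam Z Z \<le> 4/3 * inner Z Z)"
proof -
  interpret scaled_lie_algebra br H lam
    using assms by unfold_locales
  \<comment> \<open>The bound is quadratic in \<open>Z\<close> and does not extend linearly from
    brackets to their span; it transfers because the span consists of brackets.\<close>
  have "br X Y \<in> derived_algebra br" for X Y
    unfolding derived_algebra_def by (rule span_base) blast
  then show ?thesis
    unfolding nonneg_sectional_curvature_iff_br by (metis derived_algebra_eq_brackets)
qed

end
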